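(* Let $(A,d_A)$ be a compact metric space, $d,m\in\mathbb N$, and let $\sigma:\mathbb R^d\times A\to\mathbb R^{d\times m}$, $\mu:\mathbb R^d\times A\to\mathbb R^d$, $\alpha,f:\mathbb R^d\times A\to\mathbb R$ be measurable and $S:\mathbb R^d\times A\to(0,\infty)$ continuous. Assume: (i) $\sigma,\mu,\alpha,f$ are bounded; for every compact $K\subseteq\mathbb R^d\times A$ there is a constant $c_K>0$ with $\|h(x,p)-h(y,r)\|\le c_K(\|x-y\|^2+d_A(p,r)^2)^{1/2}$ for all $(x,p),(y,r)\in K$ and $h\in\{\sigma,\mu,\alpha,f\}$; there is $\epsilon_0>0$ with $\alpha(x,p)>\epsilon_0$ for all $(x,p)$; there is $\lambda>0$ with $\langle\sigma(x,p)\sigma(x,p)^Tv,v\rangle\ge\lambda\|v\|^2$ for all $x\in\mathbb R^d$, $p\in A$, $v\in\mathbb R^d$. (ii) There are $\epsilon_S,M_S\in(0,\infty)$ with $\epsilon_S<S<M_S$, and for every $h\in C^2(\mathbb R^d)$ one can choose minimisers $I_h(x)\in\operatorname{argmin}_{p\in A}\{S(x,p)(L_ph(x)-\alpha(x,p)h(x)+f(x,p))\}$, $x\in\mathbb R^d$, so that $I_h:\mathbb R^d\to A$ is locally Lipschitz; fix such a choice for every $h$. (iii) For every $K>0$ there are constants $B_K=(B_K^1,B_K^2)\in(0,\infty)^2$ and $C_K>0$ such that every $h\in\mathcal S_{B_K,K}$ satisfies $d_A(I_h(x),I_h(y))\le C_K\|x-y\|$ for all $x,y\in D_K$. (iv)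 For every $K>0$, with $B_K,C_K$ as in (iii), every locally Lipschitz $\pi:\mathbb R^d\to A$ with $d_A(\pi(x),\pi(y))\le C_K\|x-y\|$ for all $x,y\in D_K$ satisfies $V_\pi\in\mathcal S_{B_K,K}$. Let $\pi_0:\mathbb R^d\to A$ be constant and define $\pi_{n+1}:=I_{V_{\pi_n}}$ for all $n\ge0$. Then there exists a subsequence of $\{\pi_N\}_{N\in\mathbb N}$ that converges uniformly on every compact subset of $\mathbb R^d$ to a locally Lipschitz Markov policy (i.e. a locally Lipschitz function $\mathbb R^d\to A$).
   Context: $\|\cdot\|$, $\langle\cdot,\cdot\rangle$ are the Euclidean norm and inner product; for matrices $\|\cdot\|$ is the operator norm. Locally Lipschitz means Lipschitz on compact sets. $D_K=\{x\in\mathbb R^d:\|x\|\le K\}$, and for $B=(B^1,B^2)\in(0,\infty)^2$, $\mathcal S_{B,K}=\{h\in C^2(\mathbb R^d):\|\nabla h(x)\|<B^1,\ \|\mathrm Hh(x)\|<B^2\text{ for }x\in D_K\}$, with $\nabla h$ the gradient and $\mathrm Hh$ the Hessian. For a locally Lipschitz $\pi:\mathbb R^d\to A$ (a locally Lipschitz Markov policy) write $\sigma_\pi(x)=\sigma(x,\pi(x))$, and similarly $\mu_\pi,\alpha_\pi,f_\pi$. Under (i), for each $x\in\mathbb R^d$ the SDE $$X^{\pi,x}_t=x+\int_0^t\sigma_\pi(X^{\pi,x}_s)\,dB_s+\int_0^t\mu_\pi(X^{\pi,x}_s)\,ds,\quad t\ge0,$$ ($B$ an $m$-dimensional Brownian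 motion) has a unique strong non-exploding solution, and the payoff function is $$V_\pi(x)=\mathbb E\int_0^\infty e^{-\int_0^t\alpha_\pi(X^{\pi,x}_s)ds}f_\pi(X^{\pi,x}_t)\,dt.$$ For $p\in A$ and $h\in C^2(\mathbb R^d)$, $L_ph(x)=\tfrac12\mathrm{Tr}(\sigma(x,p)^T\,\mathrm Hh(x)\,\sigma(x,p))+\mu(x,p)^T\nabla h(x)$. The recursion (generalised policy iteration algorithm) is well defined because, under (i), $V_\pi\in C^2(\mathbb R^d)$ for every locally Lipschitz $\pi$, with $V_\pi$ the unique bounded solution of $\tfrac12\mathrm{Tr}(\sigma_\pi^T\mathrm HV_\pi\sigma_\pi)+\mu_\pi^T\nabla V_\pi-\alpha_\pi V_\pi+f_\pi=0$. *)

theory Defs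
  imports "HOL-Probability.Probability"
begin

section \<open>Calculus on Euclidean space\<close>

definition op_norm :: "real^'n^'m \<Rightarrow> real"
  where "op_norm A = onorm (\<lambda>v. A *v v)"

definition gradient :: "(real^'n \<Rightarrow> real) \<Rightarrow> real^'n \<Rightarrow> real^'n"
  where "gradient h x = (\<chi> i. frechet_derivative h (at x) (axis i 1))"

definition hessian :: "(real^'n \<Rightarrow> real) \<Rightarrow> real^'n \<Rightarrow> real^'n^'n"
  where "hessian h x = jacobian (gradient h) (at x)"

definition C2 :: "(real^'n \<Rightarrow> real) set"
  where "C2 = {h. (\<forall>x. h differentiable (at x)) \<and> (\<forall>x. gradient h differentiable (at x)) \<and>
                  continuous_on UNIV (hessian h)}"

definition locally_lipschitz :: "(real^'n \<Rightarrow> 'a::metric_space) \<Rightarrow> bool"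
  where "locally_lipschitz g \<longleftrightarrow> (\<forall>K. compact K \<longrightarrow> (\<exists>L. L-lipschitz_on K g))"

definition bounded_C2 :: "real \<times> real \<Rightarrow> real \<Rightarrow> (real^'n \<Rightarrow> real) set"
  where "bounded_C2 B K =
    {h \<in> C2. \<forall>x\<in>cball 0 K. norm (gradient h x) < fst B \<and> op_norm (hessian h x) < snd B}"


section \<open>Brownian motion and the Ito integral\<close>

text \<open>
  Time is represented by the real numbers, and only the values of processes at nonnegative times
  are relevant.
\<close>

locale brownian_motion = prob_space M for M :: "'w measure" +
  fixes W :: "real \<Rightarrow> 'w \<Rightarrow> real^'m"
  assumes W_measurable: "0 \<le> t \<Longrightarrow> W t \<in> borel_measurable M"
    and W_zero: "AE \<omega> in M. W 0 \<omega> = 0"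
    and W_continuous: "AE \<omega> in M. continuous_on {0..} (\<lambda>t. W t \<omega>)"
    and W_indep_increments:
      "\<lbrakk>0 \<le> \<tau> 0; \<And>i. i < n \<Longrightarrow> \<tau> i \<le> \<tau> (Suc i)\<rbrakk> \<Longrightarrow>
         indep_vars (\<lambda>_. borel) (\<lambda>i \<omega>. W (\<tau> (Suc i)) \<omega> - W (\<tau> i) \<omega>) {..<n::nat}"
    and W_indep_components:
      "\<lbrakk>0 \<le> s; s < t\<rbrakk> \<Longrightarrow> indep_vars (\<lambda>_. borel) (\<lambda>i \<omega>. (W t \<omega> - W s \<omega>) $ i) UNIV"
    and W_gaussian:
      "\<lbrakk>0 \<le> s; s < t\<rbrakk> \<Longrightarrow>
         distributed M lborel (\<lambda>\<omega>. (W t \<omega> - W s \<omega>) $ i) (normal_density 0 (sqrt (t - s)))"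

text \<open>The filtration generated by \<open>W\<close>, augmented by the null sets.\<close>

definition brownian_filtration :: "'w measure \<Rightarrow> (real \<Rightarrow> 'w \<Rightarrow> real^'m) \<Rightarrow> real \<Rightarrow> 'w measure"
  where "brownian_filtration M W t =
    sigma (space M)
      ((\<Union>s\<in>{0..t}. {W s -` A \<inter> space M | A. A \<in> sets borel}) \<union> null_sets M)"

text \<open>
  \<open>J\<close> is the integral over \<open>[0,T]\<close> with respect to \<open>W\<close> of the elementary process \<open>\<Phi>\<close>, which has
  the bounded value \<open>\<xi> i\<close>, known at time \<open>\<tau> i\<close>, on the interval from \<open>\<tau> i\<close> (excluded) to
  \<open>\<tau> (Suc i)\<close>.
\<close>

definition elementary_integral ::
  "'w measure \<Rightarrow> (real \<Rightarrow> 'w \<Rightarrow> real^'m) \<Rightarrow> real \<Rightarrow> (real \<Rightarrow> 'w \<Rightarrow> real^'m^'d) \<Rightarrow> ('w \<Rightarrow> real^'d) \<Rightarrow> bool"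
  where "elementary_integral M W T \<Phi> J \<longleftrightarrow>
    (\<exists>(n::nat) \<tau> \<xi>. \<tau> 0 = 0 \<and> \<tau> n = T \<and> (\<forall>i<n. \<tau> i \<le> \<tau> (Suc i)) \<and>
       (\<forall>i<n. \<xi> i \<in> borel_measurable (brownian_filtration M W (\<tau> i)) \<and> bounded (\<xi> i ` space M)) \<and>
       \<Phi> = (\<lambda>t \<omega>. \<Sum>i<n. indicator {\<tau> i<..\<tau> (Suc i)} t *\<^sub>R \<xi> i \<omega>) \<and>
       J = (\<lambda>\<omega>. \<Sum>i<n. \<xi> i \<omega> *v (W (\<tau> (Suc i)) \<omega> - W (\<tau> i) \<omega>)))"

text \<open>
  \<open>J\<close> is a version of the Ito integral over \<open>[0,T]\<close> of the square-integrable integrand \<open>H\<close>: the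
  \<open>L\<^sup>2\<close>-limit of the integrals of elementary processes that approximate \<open>H\<close> in \<open>L\<^sup>2(P \<times> dt)\<close>.
\<close>

definition has_ito_integral ::
  "'w measure \<Rightarrow> (real \<Rightarrow> 'w \<Rightarrow> real^'m) \<Rightarrow> real \<Rightarrow> (real \<Rightarrow> 'w \<Rightarrow> real^'m^'d) \<Rightarrow> ('w \<Rightarrow> real^'d) \<Rightarrow> bool"
  where "has_ito_integral M W T H J \<longleftrightarrow>
    J \<in> borel_measurable M \<and>
    (\<exists>\<Phi> I. (\<forall>n::nat. elementary_integral M W T (\<Phi> n) (I n)) \<and>
       (\<lambda>n. \<integral>\<^sup>+\<omega>. (\<integral>\<^sup>+t\<in>{0..T}. ennreal ((norm (\<Phi> n t \<omega> - H t \<omega>))\<^sup>2) \<partial>lborel) \<partial>M) \<longlonglongrightarrow> 0 \<and>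
       (\<lambda>n. \<integral>\<^sup>+\<omega>. ennreal ((norm (I n \<omega> - J \<omega>))\<^sup>2) \<partial>M) \<longlonglongrightarrow> 0)"


section \<open>The controlled diffusion and its payoff\<close>

text \<open>
  Strong solutions of \<open>dX = s(X) dW + b(X) dt\<close>, \<open>X\<^sub>0 = x\<close>, for bounded continuous \<open>s\<close> and \<open>b\<close>.
  The filtration contains the null sets, so requiring every path to be continuous only selects a
  version of the solution.
\<close>

definition strong_solution ::
  "'w measure \<Rightarrow> (real \<Rightarrow> 'w \<Rightarrow> real^'m) \<Rightarrow> (real^'d \<Rightarrow> real^'m^'d) \<Rightarrow> (real^'d \<Rightarrow> real^'d) \<Rightarrow>
   real^'d \<Rightarrow> (real \<Rightarrow> 'w \<Rightarrow> real^'d) \<Rightarrow> bool"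
  where "strong_solution M W s b x X \<longleftrightarrow>
    (\<forall>t\<ge>0. X t \<in> borel_measurable (brownian_filtration M W t)) \<and>
    (\<forall>\<omega>\<in>space M. continuous_on {0..} (\<lambda>t. X t \<omega>)) \<and>
    (\<forall>t\<ge>0. \<exists>J. has_ito_integral M W t (\<lambda>u \<omega>. s (X u \<omega>)) J \<and>
       (AE \<omega> in M. X t \<omega> = x + J \<omega> + (LBINT u:{0..t}. b (X u \<omega>))))"

text \<open>
  For bounded locally Lipschitz \<open>\<sigma>\<close> and \<open>\<mu>\<close> and a locally Lipschitz policy \<open>\<pi>\<close> the solution exists
  and is unique up to indistinguishability, so the payoff does not depend on the choice made here.
\<close>

definition controlled_process ::
  "'w measure \<Rightarrow> (real \<Rightarrow> 'w \<Rightarrow> real^'m) \<Rightarrow> ((real^'d) \<times> 'a \<Rightarrow> real^'m^'d) \<Rightarrow> ((real^'d) \<times> 'a \<Rightarrow> real^'d) \<Rightarrow>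
   (real^'d \<Rightarrow> 'a) \<Rightarrow> real^'d \<Rightarrow> real \<Rightarrow> 'w \<Rightarrow> real^'d"
  where "controlled_process M W \<sigma> \<mu> \<pi> x =
    (SOME X. strong_solution M W (\<lambda>y. \<sigma> (y, \<pi> y)) (\<lambda>y. \<mu> (y, \<pi> y)) x X)"

definition payoff ::
  "'w measure \<Rightarrow> (real \<Rightarrow> 'w \<Rightarrow> real^'m) \<Rightarrow> ((real^'d) \<times> 'a \<Rightarrow> real^'m^'d) \<Rightarrow> ((real^'d) \<times> 'a \<Rightarrow> real^'d) \<Rightarrow>
   ((real^'d) \<times> 'a \<Rightarrow> real) \<Rightarrow> ((real^'d) \<times> 'a \<Rightarrow> real) \<Rightarrow> (real^'d \<Rightarrow> 'a) \<Rightarrow> real^'d \<Rightarrow> real"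
  where "payoff M W \<sigma> \<mu> \<alpha> f \<pi> x =
    (let X = controlled_process M W \<sigma> \<mu> \<pi> x in
     \<integral>\<omega>. (LBINT t:{0..}. exp (- (LBINT s:{0..t}. \<alpha> (X s \<omega>, \<pi> (X s \<omega>)))) * f (X t \<omega>, \<pi> (X t \<omega>))) \<partial>M)"

definition generator ::
  "((real^'d) \<times> 'a \<Rightarrow> real^'m^'d) \<Rightarrow> ((real^'d) \<times> 'a \<Rightarrow> real^'d) \<Rightarrow> 'a \<Rightarrow> (real^'d \<Rightarrow> real) \<Rightarrow> real^'d \<Rightarrow> real"
  where "generator \<sigma> \<mu> p h x =
    1/2 * trace (transpose (\<sigma> (x, p)) ** hessian h x ** \<sigma> (x, p)) + \<mu> (x, p) \<bullet> gradient h x"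

end

theory Submission
  imports Defs
begin

text \<open>
  The policies \<open>\<pi> n\<close> are by induction \<open>C K\<close>-Lipschitz on every centred ball of radius \<open>K\<close>: (iv)
  turns this bound for \<open>\<pi> n\<close> into derivative bounds for the payoff, and (iii) turns those back into
  the same bound for \<open>\<pi> (n + 1)\<close>. As \<open>A\<close> is compact, the Arzela-Ascoli argument applies.
\<close>

text \<open>Tychonoff's theorem for countably many factors. Sequential compactness of this product
  later replaces the diagonal extraction of a subsequence.\<close>

lemma compact_UNIV_seq:
  assumes "compact (UNIV :: 'a::topological_space set)"
  shows "compact (UNIV :: (nat \<Rightarrow> 'a) set)"
proof -
  have "compactin (product_topology (\<lambda>_. euclidean) UNIV) (PiE (UNIV :: nat set) (\<lambda>_. UNIV :: 'a set))"
    using assms by (subst compactin_PiE) auto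
  then show ?thesis
    by (simp add: euclidean_product_topology PiE_UNIV_domain)
qed

lemma lipschitz_on_pointwise_limit:
  fixes F :: "nat \<Rightarrow> 'b::metric_space \<Rightarrow> 'a::metric_space"
  assumes "\<And>n. L-lipschitz_on X (F n)"
    and "\<And>x. x \<in> X \<Longrightarrow> (\<lambda>n. F n x) \<longlonglongrightarrow> g x"
  shows "L-lipschitz_on X g"
proof (rule lipschitz_onI)
  show "0 \<le> L"
    using assms(1)[of 0] by (rule lipschitz_on_nonneg)
  fix x y assume "x \<in> X" "y \<in> X"
  then have "(\<lambda>n. dist (F n x) (F n y)) \<longlonglongrightarrow> dist (g x) (g y)"
    by (intro tendsto_dist assms)
  then show "dist (g x) (g y) \<le> L * dist x y"
    by (rule LIMSEQ_le_const2) (meson assms(1) \<open>x \<in> X\<close> \<open>y \<in> X\<close> lipschitz_onD)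
qed

text \<open>A finite net of \<open>X\<close> reduces the claim to finitely many points, where
  pointwise convergence is uniform. The common constant \<open>L\<close>, which the limit inherits,
  carries the estimate from the net to all of \<open>X\<close>: moving to a net point and back costs
  e / 3 each time.\<close>

lemma lipschitz_on_uniform_limit_compact:
  fixes F :: "nat \<Rightarrow> 'b::metric_space \<Rightarrow> 'a::metric_space"
  assumes "compact X" and lip: "\<And>n. L-lipschitz_on X (F n)"
    and lim: "\<And>x. x \<in> X \<Longrightarrow> (\<lambda>n. F n x) \<longlonglongrightarrow> g x"
  shows "uniform_limit X F g sequentially"
proof (rule uniform_limitI)
  fix e :: real assume "0 < e"
  have L: "0 \<le> L"
    using lip[of 0] by (rule lipschitz_on_nonneg)
  have g: "L-lipschitz_on X g"
    using lip lim by (rule lipschitz_on_pointwise_limit)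
  \<comment> \<open>Dividing by \<open>L + 1\<close> keeps the radius well defined and positive when
    \<open>L\<close> is 0.\<close>
  define \<delta> where "\<delta> = e / (3 * (L + 1))"
  have "0 < \<delta>"
    using \<open>0 < e\<close> L by (simp add: \<delta>_def)
  have "L * \<delta> \<le> (L + 1) * \<delta>"
    using \<open>0 < \<delta>\<close> by simp
  also have "\<dots> = e / 3"
    using L by (simp add: \<delta>_def field_simps)
  finally have \<delta>: "L * \<delta> \<le> e / 3" .
  \<comment> \<open>The net must lie inside \<open>X\<close>, since both the Lipschitz bound and the
    convergence are given only there.\<close>
  obtain T where T: "finite T" "T \<subseteq> X" "X \<subseteq> (\<Union>y\<in>T. ball y \<delta>)"
    using seq_compact_imp_totally_bounded[of X] \<open>compact X\<close> \<open>0 < \<delta>\<close>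
    by (metis compact_imp_seq_compact)
  have "\<forall>\<^sub>F n in sequentially. \<forall>y\<in>T. dist (F n y) (g y) < e / 3"
    using T lim \<open>0 < e\<close> by (intro eventually_ball_finite ballI tendstoD) auto
  then show "\<forall>\<^sub>F n in sequentially. \<forall>x\<in>X. dist (F n x) (g x) < e"
  proof eventually_elim
    case (elim n)
    show ?case
    proof
      fix x assume "x \<in> X"
      then obtain y where y: "y \<in> T" "dist y x < \<delta>"
        using T(3) by auto
      then have "y \<in> X" "dist x y < \<delta>"
        using T(2) by (auto simp: dist_commute)
      have "L * dist x y \<le> L * \<delta>" "L * dist y x \<le> L * \<delta>"
        using y L \<open>dist x y < \<delta>\<close> by (auto intro: mult_left_mono)
      then have "dist (F n x) (F n y) \<le> e / 3" "dist (g y) (g x) \<le> e / 3"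
        using lipschitz_onD[OF lip \<open>x \<in> X\<close> \<open>y \<in> X\<close>, of n] lipschitz_onD[OF g \<open>y \<in> X\<close> \<open>x \<in> X\<close>] \<delta>
        by linarith+
      moreover have "dist (F n y) (g y) < e / 3"
        using elim y by blast
      ultimately show "dist (F n x) (g x) < e"
        using dist_triangle[of "F n x" "g x" "F n y"] dist_triangle[of "F n y" "g x" "g y"]
        by linarith
    qed
  qed
qed

text \<open>Arzela-Ascoli for a compact target. The subsequence is fixed by convergence on a
  countable dense subset of the whole space, so the same \<open>r\<close> serves every compact set.
  Local equi-Lipschitz bounds then spread convergence from the dense set to every point.\<close>

lemma locally_equi_lipschitz_subsequence:
  fixes F :: "nat \<Rightarrow> 'b::euclidean_space \<Rightarrow> 'a::metric_space"
  assumes "compact (UNIV :: 'a set)"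
    and lip: "\<And>X. compact X \<Longrightarrow> \<exists>L. \<forall>n. L-lipschitz_on X (F n)"
  obtains r g where "strict_mono (r :: nat \<Rightarrow> nat)"
    and "\<And>X. compact X \<Longrightarrow> \<exists>L. L-lipschitz_on X g"
    and "\<And>X. compact X \<Longrightarrow> uniform_limit X (\<lambda>n. F (r n)) g sequentially"
proof -
  obtain D :: "'b set" where D: "countable D" "\<And>X. open X \<Longrightarrow> X \<noteq> {} \<Longrightarrow> \<exists>d\<in>D. d \<in> X"
    using countable_dense_exists by auto
  define q where "q = from_nat_into D"
  \<comment> \<open>Each \<open>F n\<close> is read as the point of the product space that lists its
    values along \<open>q\<close>. Convergence there means convergence at every
    \<open>q i\<close>.\<close>
  have "seq_compact (UNIV :: (nat \<Rightarrow> 'a) set)"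
    by (intro compact_imp_seq_compact compact_UNIV_seq assms)
  then obtain l r where r: "strict_mono (r :: nat \<Rightarrow> nat)"
    and l: "((\<lambda>n i. F n (q i)) \<circ> r) \<longlonglongrightarrow> l"
    by (rule seq_compactE[where f = "\<lambda>n i. F n (q i)"]) auto
  have dense: "(\<lambda>n. F (r n) (q i)) \<longlonglongrightarrow> l i" for i
    using continuous_on_tendsto_compose[OF continuous_on_product_coordinates l, of i]
    by (simp add: o_def)
  have "Cauchy (\<lambda>n. F (r n) x)" for x
  proof (rule metric_CauchyI)
    fix e :: real assume "0 < e"
    obtain L where L: "\<And>n. L-lipschitz_on (cball x 1) (F n)"
      using lip[of "cball x 1"] by auto
    then have "0 \<le> L"
      by (metis lipschitz_on_nonneg)
    \<comment> \<open>The cap 1 keeps the nearby dense point inside the ball on which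
      \<open>L\<close> is valid.\<close>
    define \<delta> where "\<delta> = min 1 (e / (3 * (L + 1)))"
    have "0 < \<delta>"
      using \<open>0 < e\<close> \<open>0 \<le> L\<close> by (simp add: \<delta>_def)
    have "L * \<delta> \<le> (L + 1) * (e / (3 * (L + 1)))"
      using \<open>0 < \<delta>\<close> \<open>0 \<le> L\<close> by (intro mult_mono) (auto simp: \<delta>_def)
    also have "\<dots> = e / 3"
      using \<open>0 \<le> L\<close> by (simp add: field_simps)
    finally have \<delta>: "L * \<delta> \<le> e / 3" .
    obtain d where "d \<in> D" "d \<in> ball x \<delta>"
      using D(2)[of "ball x \<delta>"] \<open>0 < \<delta>\<close> by auto
    then obtain i where i: "dist x (q i) < \<delta>"
      unfolding q_def using \<open>countable D\<close> from_nat_into_surj by (metis mem_ball)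
    have near: "dist (F n x) (F n (q i)) \<le> e / 3" for n
    proof -
      have "dist (F n x) (F n (q i)) \<le> L * dist x (q i)"
        using i by (intro lipschitz_onD[OF L]) (auto simp: \<delta>_def)
      also have "\<dots> \<le> L * \<delta>"
        using i \<open>0 \<le> L\<close> by (intro mult_left_mono) auto
      finally show ?thesis
        using \<delta> by linarith
    qed
    obtain N where N: "\<And>m n. m \<ge> N \<Longrightarrow> n \<ge> N \<Longrightarrow> dist (F (r m) (q i)) (F (r n) (q i)) < e / 3"
      using metric_CauchyD[OF LIMSEQ_imp_Cauchy[OF dense[of i]], of "e / 3"] \<open>0 < e\<close> by auto
    show "\<exists>N. \<forall>m\<ge>N. \<forall>n\<ge>N. dist (F (r m) x) (F (r n) x) < e"
    proof (intro exI allI impI)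
      fix m n assume "N \<le> m" "N \<le> n"
      have "dist (F (r n) (q i)) (F (r n) x) \<le> e / 3"
        using near[of "r n"] by (simp add: dist_commute)
      then show "dist (F (r m) x) (F (r n) x) < e"
        using near[of "r m"] N[OF \<open>N \<le> m\<close> \<open>N \<le> n\<close>]
          dist_triangle[of "F (r m) x" "F (r n) x" "F (r m) (q i)"]
          dist_triangle[of "F (r m) (q i)" "F (r n) x" "F (r n) (q i)"]
        by linarith
    qed
  qed
  \<comment> \<open>Completeness of the target comes from its compactness.\<close>
  then have "\<exists>y. (\<lambda>n. F (r n) x) \<longlonglongrightarrow> y" for x
    using compact_imp_complete[OF assms(1)] unfolding complete_def by blast
  then obtain g where g: "\<And>x. (\<lambda>n. F (r n) x) \<longlonglongrightarrow> g x"
    by metis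
  show thesis
  proof (rule that[OF r, of g])
    fix X :: "'b set" assume "compact X"
    then obtain L where L: "\<And>n. L-lipschitz_on X (F (r n))"
      using lip by blast
    show "\<exists>L. L-lipschitz_on X g"
      using lipschitz_on_pointwise_limit[of L X "\<lambda>n. F (r n)" g] L g by blast
    show "uniform_limit X (\<lambda>n. F (r n)) g sequentially"
      using \<open>compact X\<close> L g by (rule lipschitz_on_uniform_limit_compact)
  qed
qed

theorem proposition3:
  fixes M :: "'w measure"
    and W :: "real \<Rightarrow> 'w \<Rightarrow> real^'m"
    and \<sigma> :: "(real^'d) \<times> 'a::metric_space \<Rightarrow> real^'m^'d"
    and \<mu> :: "(real^'d) \<times> 'a \<Rightarrow> real^'d"
    and \<alpha> f S :: "(real^'d) \<times> 'a \<Rightarrow> real"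
    and I :: "(real^'d \<Rightarrow> real) \<Rightarrow> real^'d \<Rightarrow> 'a"
    and B :: "real \<Rightarrow> real \<times> real" and C :: "real \<Rightarrow> real"
    and \<pi> :: "nat \<Rightarrow> real^'d \<Rightarrow> 'a"
  assumes "compact (UNIV :: 'a set)"
    and "brownian_motion M W"
    and "\<sigma> \<in> borel_measurable borel" "\<mu> \<in> borel_measurable borel"
      "\<alpha> \<in> borel_measurable borel" "f \<in> borel_measurable borel"
    and "continuous_on UNIV S" "\<forall>z. 0 < S z"
    \<comment> \<open>(i)\<close>
    and "bounded (range \<sigma>)" "bounded (range \<mu>)" "bounded (range \<alpha>)" "bounded (range f)"
    and "\<forall>K. compact K \<longrightarrow> (\<exists>c>0. \<forall>(x, p)\<in>K. \<forall>(y, r)\<in>K.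
           op_norm (\<sigma> (x, p) - \<sigma> (y, r)) \<le> c * sqrt ((norm (x - y))\<^sup>2 + (dist p r)\<^sup>2) \<and>
           norm (\<mu> (x, p) - \<mu> (y, r)) \<le> c * sqrt ((norm (x - y))\<^sup>2 + (dist p r)\<^sup>2) \<and>
           \<bar>\<alpha> (x, p) - \<alpha> (y, r)\<bar> \<le> c * sqrt ((norm (x - y))\<^sup>2 + (dist p r)\<^sup>2) \<and>
           \<bar>f (x, p) - f (y, r)\<bar> \<le> c * sqrt ((norm (x - y))\<^sup>2 + (dist p r)\<^sup>2))"
    and "\<exists>\<epsilon>\<^sub>0>0. \<forall>x p. \<epsilon>\<^sub>0 < \<alpha> (x, p)"
    and "\<exists>\<kappa>>0. \<forall>x p v. \<kappa> * (norm v)\<^sup>2 \<le> ((\<sigma> (x, p) ** transpose (\<sigma> (x, p))) *v v) \<bullet> v"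
    \<comment> \<open>(ii)\<close>
    and "\<exists>\<epsilon>\<^sub>S>0. \<exists>M\<^sub>S>0. \<forall>z. \<epsilon>\<^sub>S < S z \<and> S z < M\<^sub>S"
    and "\<forall>h\<in>C2. (\<forall>x. is_arg_min (\<lambda>p. S (x, p) * (generator \<sigma> \<mu> p h x - \<alpha> (x, p) * h x + f (x, p)))
                       (\<lambda>p. True) (I h x)) \<and>
                locally_lipschitz (I h)"
    \<comment> \<open>(iii)\<close>
    and "\<forall>K>0. 0 < fst (B K) \<and> 0 < snd (B K) \<and> 0 < C K \<and>
           (\<forall>h\<in>bounded_C2 (B K) K. \<forall>x\<in>cball 0 K. \<forall>y\<in>cball 0 K.
              dist (I h x) (I h y) \<le> C K * norm (x - y))"
    \<comment> \<open>(iv)\<close>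
    and "\<forall>K>0. \<forall>\<rho>. locally_lipschitz \<rho> \<and>
             (\<forall>x\<in>cball 0 K. \<forall>y\<in>cball 0 K. dist (\<rho> x) (\<rho> y) \<le> C K * norm (x - y)) \<longrightarrow>
           payoff M W \<sigma> \<mu> \<alpha> f \<rho> \<in> bounded_C2 (B K) K"
    \<comment> \<open>the generalised policy iteration\<close>
    and "\<pi> 0 constant_on UNIV"
    and "\<forall>n. \<pi> (Suc n) = I (payoff M W \<sigma> \<mu> \<alpha> f (\<pi> n))"
  shows "\<exists>r \<pi>_lim. strict_mono (r :: nat \<Rightarrow> nat) \<and> locally_lipschitz \<pi>_lim \<and>
           (\<forall>K. compact K \<longrightarrow> uniform_limit K (\<lambda>n. \<pi> (r n)) \<pi>_lim sequentially)"
proof -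
  let ?V = "payoff M W \<sigma> \<mu> \<alpha> f"
  let ?lip = "\<lambda>\<rho> K. \<forall>x\<in>cball 0 K. \<forall>y\<in>cball 0 K. dist (\<rho> x) (\<rho> y) \<le> C K * norm (x - y)"
  note ii = assms(17) and iii = assms(18) and iv = assms(19)
    and const = assms(20) and rec = assms(21)
  \<comment> \<open>Local Lipschitz continuity is carried along because (iv) demands it besides the
    bound on the ball. (ii) restores it for the next policy, and (iii) restores the bound.\<close>
  have bound: "locally_lipschitz (\<pi> n) \<and> (\<forall>K>0. ?lip (\<pi> n) K)" for n
  proof (induction n)
    case 0
    have c: "\<pi> 0 x = \<pi> 0 y" for x y
      using const by (auto simp: constant_on_def)
    have "0-lipschitz_on K (\<pi> 0)" for K
      by (rule lipschitz_onI) (use c in auto)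
    moreover have "dist (\<pi> 0 x) (\<pi> 0 y) \<le> C K * norm (x - y)" if "0 < K" for K x y
      using iii that c[of x y] by (simp add: less_imp_le)
    ultimately show ?case
      unfolding locally_lipschitz_def by blast
  next
    case (Suc n)
    have V: "?V (\<pi> n) \<in> bounded_C2 (B K) K" if "0 < K" for K
      using Suc.IH iv that by blast
    \<comment> \<open>Smoothness does not depend on the radius, so radius 1 suffices. It is what
      lets (ii) apply to the payoff.\<close>
    then have "?V (\<pi> n) \<in> C2"
      using zero_less_one unfolding bounded_C2_def by blast
    then show ?case
      using V ii iii rec by simp
  qed
  have equi: "\<exists>L. \<forall>n. L-lipschitz_on X (\<pi> n)" if X: "compact X" for X
  proof -
    \<comment> \<open>A strictly positive radius is required, as \<open>C K\<close> is controlled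
      only for such \<open>K\<close>. The resulting constant is the same for all
      \<open>n\<close>.\<close>
    obtain K where K: "0 < K" "X \<subseteq> cball 0 K"
      using bounded_subset_ballD[OF compact_imp_bounded[OF X], of 0] ball_subset_cball by blast
    have "(C K)-lipschitz_on X (\<pi> n)" for n
    proof (rule lipschitz_onI)
      show "0 \<le> C K"
        using iii K by (simp add: less_imp_le)
      show "dist (\<pi> n x) (\<pi> n y) \<le> C K * dist x y" if "x \<in> X" "y \<in> X" for x y
        using bound[of n] K that unfolding dist_norm[of x y] by blast
    qed
    then show ?thesis
      by blast
  qed
  obtain r g where "strict_mono (r :: nat \<Rightarrow> nat)"
    and "\<And>X. compact X \<Longrightarrow> \<exists>L. L-lipschitz_on X g"
    and "\<And>X. compact X \<Longrightarrow> uniform_limit X (\<lambda>n. \<pi> (r n)) g sequentially"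
    using locally_equi_lipschitz_subsequence[OF assms(1) equi] by metis
  then show ?thesis
    unfolding locally_lipschitz_def by blast
qed

end
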